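(* For every integer $k\ge 0$ and all $t,x\in\mathbb{R}$, the exponential generating function $G_k(t,x):=\sum_{v=0}^{\infty}c_k(v,x)\frac{t^v}{v!}$ satisfies $$G_k(t,x)=\sum_{v=0}^{\infty}c_k(v,x)\frac{t^v}{v!}=\frac{1}{k!}\left(\frac{t(1-x)}{2}\right)^{k}e^{t\left(\frac{x+1}{2}\right)}.$$
   Context: For integers $v,k\ge 0$ and real $x$, the superoscillatory coefficients are $$c_k(v,x)=\binom{v}{k}\left(\frac{1+x}{2}\right)^{v-k}\left(\frac{1-x}{2}\right)^{k},$$ where $\binom{v}{k}=\frac{v(v-1)\cdots(v-k+1)}{k!}$; in particular $c_k(v,x)=0$ when $k>v$. *)

theory Defs
  imports Complex_Main
begin

(* For k > v the exponent v - k is truncated to 0; this is harmless, since then v choose k = 0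
   and the coefficient is 0, as it should be. *)
definition superosc_coeff :: "nat \<Rightarrow> nat \<Rightarrow> real \<Rightarrow> real" where
  "superosc_coeff k v x = real (v choose k) * ((1 + x) / 2) ^ (v - k) * ((1 - x) / 2) ^ k"

definition superosc_egf :: "nat \<Rightarrow> real \<Rightarrow> real \<Rightarrow> real" where
  "superosc_egf k t x = (\<Sum>v. superosc_coeff k v x * (t ^ v / fact v))"

end

theory Submission
  imports Defs
begin

text \<open>
  The binomial coefficient removes the first \<open>k\<close> terms and, in the remaining ones, cancels
  \<open>v!\<close> down to \<open>k! (v - k)!\<close>. Writing \<open>v = n + k\<close>, the generating function is therefore a constant
  multiple of the exponential series at \<open>t (1 + x) / 2\<close>, which converges everywhere.
\<close>

lemma superosc_coeff_eq_0: "v < k \<Longrightarrow> superosc_coeff k v x = 0"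
  by (simp add: superosc_coeff_def)

lemma superosc_coeff_shift:
  "superosc_coeff k (n + k) x * (t ^ (n + k) / fact (n + k))
    = 1 / fact k * (t * (1 - x) / 2) ^ k * ((t * ((x + 1) / 2)) ^ n /\<^sub>R fact n)"
proof -
  have "real (n + k choose k) = fact (n + k) / (fact k * fact n)"
    by (simp add: binomial_fact)
  moreover have "(t * (1 - x) / 2) ^ k = t ^ k * ((1 - x) / 2) ^ k"
    by (simp only: power_mult_distrib flip: times_divide_eq_right)
  moreover have "(t * ((x + 1) / 2)) ^ n = t ^ n * ((1 + x) / 2) ^ n"
    by (simp only: power_mult_distrib add.commute[of x 1])
  ultimately show ?thesis
    by (simp only: superosc_coeff_def power_add add_diff_cancel_right')
      (simp add: field_simps del: power_divide)
qed

lemma superosc_egf_sums: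
  "(\<lambda>v. superosc_coeff k v x * (t ^ v / fact v)) sums
    (1 / fact k * (t * (1 - x) / 2) ^ k * exp (t * ((x + 1) / 2)))"
proof -
  let ?f = "\<lambda>v. superosc_coeff k v x * (t ^ v / fact v)"
  let ?s = "1 / fact k * (t * (1 - x) / 2) ^ k * exp (t * ((x + 1) / 2))"
  have "(\<lambda>n. ?f (n + k)) sums ?s"
    unfolding superosc_coeff_shift by (intro sums_mult exp_converges)
  moreover have "?f v = 0" if "v < k" for v
    using that by (simp add: superosc_coeff_eq_0)
  ultimately show ?thesis
    using sums_zero_iff_shift[of k ?f ?s] by blast
qed

theorem lemma2p9:
  fixes k :: nat and t x :: real
  shows "summable (\<lambda>v. superosc_coeff k v x * (t ^ v / fact v)) \<and>
    superosc_egf k t x = 1 / fact k * (t * (1 - x) / 2) ^ k * exp (t * ((x + 1) / 2))"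
  using superosc_egf_sums[of k x t] unfolding superosc_egf_def
  by (blast intro: sums_summable sums_unique[symmetric])

end
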